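(* Let $\alpha_1,\ldots,\alpha_n\ge 0$. If $(S_k-\alpha_k)_{k=1}^n$ is an increasing process, then $$V_0^{\mathrm{CVaR}}=\mathbb E[S_n]-\alpha_n.$$
   Context: Setting: $(\Omega,\mathcal F,\mathbb P)$ is a probability space with a discrete filtration $\mathbb F=(\mathcal F_k)_{k=0}^n$, $n\ge 1$, with $\mathcal F_0$ trivial; the pricing measure $\mathbb Q$ equals $\mathbb P$ and $\mathbb E$ denotes expectation under $\mathbb P$; $S_0=0$ and $S_k=P_1+\dots+P_k$, where each $P_i$ is $\mathcal F_i$-measurable with $\mathbb E[|P_i|]<\infty$. "Increasing" is in the weak sense (non-decreasing). $x^+=\max(x,0)$. Let $\lambda\in(0,1)$. For a random variable $X\in L^1$ representing a loss, $$\mathrm{CVaR}_\lambda(X)=\sup_{\tilde{\mathbb P}}\Big\{\mathbb E^{\tilde{\mathbb P}}[X] : \frac{d\tilde{\mathbb P}}{d\mathbb P}\leq\frac{1}{1-\lambda}\Big\},$$ the supremum being over probability measures $\tilde{\mathbb P}$ absolutely continuous with respect to $\mathbb P$. $\mathcal M_{\mathrm{CVaR}}$ is the set of all $\mathbb F$-supermartingales $(M_k)_{k=0}^n$ such that $\mathrm{CVaR}_\lambda[(S_k-M_k)^+]\leq\alpha_k$ for any $k\in\{1,\ldots,n\}$, and $V_0^{\mathrm{CVaR}}:=\inf_{(M_k)_{k=0}^n\in\mathcal M_{\mathrm{CVaR}}}M_0$. *)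

theory Defs
  imports "HOL-Probability.Probability"
begin

definition discrete_filtration :: "'a measure \<Rightarrow> nat \<Rightarrow> (nat \<Rightarrow> 'a measure) \<Rightarrow> bool" where
  "discrete_filtration Pr n F \<longleftrightarrow>
     (\<forall>k\<le>n. subalgebra Pr (F k)) \<and> (\<forall>j k. j \<le> k \<and> k \<le> n \<longrightarrow> sets (F j) \<subseteq> sets (F k))"

text \<open>Triviality is up to null sets; the case where the \<open>\<sigma>\<close>-algebra consists of the empty set and
  the whole space only is included.\<close>

definition trivial_algebra :: "'a measure \<Rightarrow> 'a measure \<Rightarrow> bool" where
  "trivial_algebra Pr G \<longleftrightarrow> (\<forall>A\<in>sets G. measure Pr A = 0 \<or> measure Pr A = 1)"

definition supermartingale ::
    "'a measure \<Rightarrow> nat \<Rightarrow> (nat \<Rightarrow> 'a measure) \<Rightarrow> (nat \<Rightarrow> 'a \<Rightarrow> real) \<Rightarrow> bool" where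
  "supermartingale Pr n F M \<longleftrightarrow>
     (\<forall>k\<le>n. M k \<in> borel_measurable (F k) \<and> integrable Pr (M k)) \<and>
     (\<forall>j k. j \<le> k \<and> k \<le> n \<longrightarrow> (AE \<omega> in Pr. real_cond_exp Pr (F j) (M k) \<omega> \<le> M j \<omega>))"

definition partial_sum :: "(nat \<Rightarrow> 'a \<Rightarrow> real) \<Rightarrow> nat \<Rightarrow> 'a \<Rightarrow> real" where
  "partial_sum P k \<omega> = (\<Sum>i=1..k. P i \<omega>)"

definition CVaR_measures :: "'a measure \<Rightarrow> real \<Rightarrow> 'a measure set" where
  "CVaR_measures Pr lam =
     {Q. prob_space Q \<and> sets Q = sets Pr \<and> absolutely_continuous Pr Q \<and>
         (AE \<omega> in Pr. RN_deriv Pr Q \<omega> \<le> ennreal (1 / (1 - lam)))}"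

text \<open>The risk measure and the value below are extended reals, so that suprema and infima
  carry no convention for empty or unbounded sets of reals. The argument \<open>X\<close> is meant to be
  integrable, in which case it is integrable under every measure in the supremum.\<close>

definition CVaR :: "'a measure \<Rightarrow> real \<Rightarrow> ('a \<Rightarrow> real) \<Rightarrow> ereal" where
  "CVaR Pr lam X = (SUP Q\<in>CVaR_measures Pr lam. ereal (integral\<^sup>L Q X))"

definition M_CVaR ::
    "'a measure \<Rightarrow> nat \<Rightarrow> (nat \<Rightarrow> 'a measure) \<Rightarrow> real \<Rightarrow> (nat \<Rightarrow> 'a \<Rightarrow> real) \<Rightarrow> (nat \<Rightarrow> real) \<Rightarrow>
     (nat \<Rightarrow> 'a \<Rightarrow> real) set" where
  "M_CVaR Pr n F lam S \<alpha> =
     {M. supermartingale Pr n F M \<and>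
         (\<forall>k\<in>{1..n}. CVaR Pr lam (\<lambda>\<omega>. max (S k \<omega> - M k \<omega>) 0) \<le> ereal (\<alpha> k))}"

text \<open>When \<open>F 0\<close> is trivial, \<open>M 0\<close> is almost surely equal to a unique real \<open>m\<close>; this \<open>m\<close> is
  the initial value over which the infimum is taken.\<close>

definition V0_CVaR ::
    "'a measure \<Rightarrow> nat \<Rightarrow> (nat \<Rightarrow> 'a measure) \<Rightarrow> real \<Rightarrow> (nat \<Rightarrow> 'a \<Rightarrow> real) \<Rightarrow> (nat \<Rightarrow> real) \<Rightarrow>
     ereal" where
  "V0_CVaR Pr n F lam S \<alpha> =
     Inf {ereal m | m. \<exists>M\<in>M_CVaR Pr n F lam S \<alpha>. AE \<omega> in Pr. M 0 \<omega> = m}"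

end

theory Submission
  imports Defs
begin

text \<open>Testing the risk constraint at time \<open>n\<close> with \<open>Pr\<close> itself gives
  \<open>E[S\<^sub>n - M\<^sub>n] \<le> \<alpha>\<^sub>n\<close>, and a supermartingale satisfies \<open>E[M\<^sub>n] \<le> M\<^sub>0\<close>. Conversely the
  martingale \<open>M\<^sub>k = E[S\<^sub>n - \<alpha>\<^sub>n | F\<^sub>k]\<close> dominates \<open>S\<^sub>k - \<alpha>\<^sub>k\<close> by monotonicity, so the shortfall
  \<open>(S\<^sub>k - M\<^sub>k)\<^sup>+\<close> is almost surely bounded by the constant \<open>\<alpha>\<^sub>k\<close>.\<close>

text \<open>Conditional expectation is characterised by its integrals over the sets of
  \<open>G\<close>. Over a null set both integrals vanish, over a set of probability one both equal
  \<open>expectation X\<close>, and no other sets occur.\<close>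

lemma (in prob_space) real_cond_exp_trivial_algebra:
  assumes "subalgebra M G" "trivial_algebra M G" "integrable M X"
  shows "AE \<omega> in M. real_cond_exp M G X \<omega> = expectation X"
proof -
  interpret G: finite_measure_subalgebra M G
    by unfold_locales fact
  show ?thesis
  proof (rule G.real_cond_exp_charact)
    fix A assume A: "A \<in> sets G"
    then have AM: "A \<in> events"
      using assms(1) by (auto simp: subalgebra_def)
    consider "prob A = 0" | "prob A = 1"
      using A assms(2) by (auto simp: trivial_algebra_def)
    then show "(\<integral>\<omega>\<in>A. X \<omega> \<partial>M) = (\<integral>\<omega>\<in>A. expectation X \<partial>M)"
    proof cases
      case 1
      then have "AE \<omega> in M. \<omega> \<notin> A"
        using AM by (simp add: prob_eq_0)
      \<comment> \<open>The integrand \<open>f\<close> is left arbitrary so that one fact settles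
        both sides of the identity.\<close>
      then have "set_lebesgue_integral M A f = 0" for f :: "'a \<Rightarrow> real"
        unfolding set_lebesgue_integral_def
        by (intro integral_eq_zero_AE) (auto simp: indicator_def)
      then show ?thesis by simp
    next
      case 2
      then have ae: "AE \<omega> in M. \<omega> \<in> A"
        using AM by (simp add: prob_eq_1)
      have "(\<integral>\<omega>\<in>A. X \<omega> \<partial>M) = expectation X"
        unfolding set_lebesgue_integral_def
        using ae AM assms(3) by (intro integral_cong_AE) (auto simp: indicator_def)
      moreover have "(\<integral>\<omega>\<in>A. expectation X \<partial>M) = expectation X"
        using AM 2 by (simp add: set_lebesgue_integral_def)
      ultimately show ?thesis by simp
    qed
  qed (use assms(3) in auto)
qed

text \<open>The measure \<open>M\<close> itself competes in the supremum: its density 1 is at most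
  \<open>1 / (1 - lam)\<close>.\<close>

lemma (in prob_space) expectation_le_CVaR:
  assumes "0 \<le> lam" "lam < 1"
  shows "ereal (expectation X) \<le> CVaR M lam X"
proof -
  have "density M (\<lambda>_. 1) = M"
    by (rule density_1)
  \<comment> \<open>\<open>RN_deriv\<close> is a chosen density, so it is identified with 1 only
    almost everywhere, through uniqueness.\<close>
  then have "AE \<omega> in M. 1 = RN_deriv M M \<omega>"
    by (intro RN_deriv_unique) auto
  moreover have "1 \<le> ennreal (1 / (1 - lam))"
    using assms by (subst ennreal_1[symmetric], intro ennreal_leI) (simp add: field_simps)
  ultimately have "M \<in> CVaR_measures M lam"
    unfolding CVaR_measures_def
    by (auto simp: prob_space_axioms absolutely_continuous_def elim: eventually_mono)
  then show ?thesis
    unfolding CVaR_def by (rule SUP_upper)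
qed

text \<open>An almost sure bound passes to every absolutely continuous \<open>Q\<close>, and
  averaging under a probability measure preserves it.\<close>

lemma CVaR_le_const:
  assumes "AE \<omega> in M. X \<omega> \<le> c" "0 \<le> c"
  shows "CVaR M lam X \<le> ereal c"
  unfolding CVaR_def
proof (rule SUP_least)
  fix Q assume "Q \<in> CVaR_measures M lam"
  then have Q: "prob_space Q" "sets Q = sets M" "absolutely_continuous M Q"
    by (auto simp: CVaR_measures_def)
  have "AE \<omega> in Q. X \<omega> \<le> c"
    using absolutely_continuous_AE[OF Q(2,3) assms(1)] by simp
  \<comment> \<open>If \<open>X\<close> is not integrable under \<open>Q\<close>, its integral is 0
    by convention; \<open>0 \<le> c\<close> covers this case.\<close>
  then have "integral\<^sup>L Q X \<le> c"
    using assms(2) prob_space.integral_le_const[OF Q(1), of X c] not_integrable_integral_eq[of Q X]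
    by (cases "integrable Q X") auto
  then show "ereal (integral\<^sup>L Q X) \<le> ereal c" by simp
qed

theorem proposition13:
  fixes Pr :: "'a measure" and F :: "nat \<Rightarrow> 'a measure"
    and P :: "nat \<Rightarrow> 'a \<Rightarrow> real" and \<alpha> :: "nat \<Rightarrow> real"
    and n :: nat and lam :: real
  assumes "prob_space Pr"
    and "n \<ge> 1"
    and "discrete_filtration Pr n F"
    and "trivial_algebra Pr (F 0)"
    and "\<And>i. i \<in> {1..n} \<Longrightarrow> P i \<in> borel_measurable (F i)"
    and "\<And>i. i \<in> {1..n} \<Longrightarrow> integrable Pr (P i)"
    and "0 < lam" and "lam < 1"
    and "\<And>k. k \<in> {1..n} \<Longrightarrow> \<alpha> k \<ge> 0"
    and "AE \<omega> in Pr. mono_on {1..n} (\<lambda>k. partial_sum P k \<omega> - \<alpha> k)"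
  shows "V0_CVaR Pr n F lam (partial_sum P) \<alpha> =
           ereal (integral\<^sup>L Pr (partial_sum P n) - \<alpha> n)"
proof -
  interpret prob_space Pr by fact
  let ?S = "partial_sum P" and ?v = "integral\<^sup>L Pr (partial_sum P n) - \<alpha> n"
  have n: "n \<in> {1..n}"
    using assms(2) by simp
  have sub: "subalgebra Pr (F k)" if "k \<le> n" for k
    using assms(3) that by (simp add: discrete_filtration_def)
  have sub_mono: "subalgebra (F k) (F j)" if "j \<le> k" "k \<le> n" for j k
    using assms(3) that sub[of j] sub[of k]
    by (auto simp: discrete_filtration_def subalgebra_def)
  have fms: "finite_measure_subalgebra Pr (F k)" if "k \<le> n" for k
    using sub[OF that] by unfold_locales
  have S_int: "integrable Pr (?S k)" if "k \<le> n" for k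
    using assms(6) that unfolding partial_sum_def by (intro Bochner_Integration.integrable_sum) auto
  have S_meas: "?S k \<in> borel_measurable (F k)" if "k \<le> n" for k
    unfolding partial_sum_def
  proof (rule borel_measurable_sum)
    fix i assume "i \<in> {1..k}"
    then show "P i \<in> borel_measurable (F k)"
      using that measurable_from_subalg[OF sub_mono[of i k]] assms(5)[of i] by auto
  qed

  have lower: "?v \<le> m" if M: "M \<in> M_CVaR Pr n F lam ?S \<alpha>" and m: "AE \<omega> in Pr. M 0 \<omega> = m" for M m
  proof -
    interpret F0: finite_measure_subalgebra Pr "F 0"
      using fms by simp
    have int: "integrable Pr (M n)" and le: "AE \<omega> in Pr. real_cond_exp Pr (F 0) (M n) \<omega> \<le> M 0 \<omega>"
      using M by (auto simp: M_CVaR_def supermartingale_def)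
    have "AE \<omega> in Pr. real_cond_exp Pr (F 0) (M n) \<omega> \<le> m"
      using le m by eventually_elim simp
    \<comment> \<open>Conditioning preserves the expectation, so integrating the almost sure bound
      by the constant \<open>m\<close> bounds \<open>expectation (M n)\<close>.\<close>
    then have "expectation (M n) \<le> m"
      using integral_le_const[OF F0.real_cond_exp_int(1)[OF int]] F0.real_cond_exp_int(2)[OF int]
      by simp
    moreover have "expectation (?S n) - expectation (M n) \<le> \<alpha> n"
    proof -
      have "expectation (?S n) - expectation (M n) = expectation (\<lambda>\<omega>. ?S n \<omega> - M n \<omega>)"
        using S_int int by simp
      also have "\<dots> \<le> expectation (\<lambda>\<omega>. max (?S n \<omega> - M n \<omega>) 0)"
        using S_int int by (intro integral_mono integrable_max) auto
      finally have "ereal (expectation (?S n) - expectation (M n))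
          \<le> ereal (expectation (\<lambda>\<omega>. max (?S n \<omega> - M n \<omega>) 0))"
        by simp
      also have "\<dots> \<le> CVaR Pr lam (\<lambda>\<omega>. max (?S n \<omega> - M n \<omega>) 0)"
        using assms(7,8) by (intro expectation_le_CVaR) auto
      also have "\<dots> \<le> ereal (\<alpha> n)"
        using M n by (auto simp: M_CVaR_def)
      finally show ?thesis by simp
    qed
    ultimately show ?thesis by simp
  qed

  define M where "M k = real_cond_exp Pr (F k) (\<lambda>\<omega>. ?S n \<omega> - \<alpha> n)" for k
  have X_int: "integrable Pr (\<lambda>\<omega>. ?S n \<omega> - \<alpha> n)"
    using S_int by simp
  have "supermartingale Pr n F M"
    unfolding supermartingale_def
  proof (intro conjI allI impI)
    fix k assume "k \<le> n"
    then interpret Fk: finite_measure_subalgebra Pr "F k"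
      using fms by simp
    show "M k \<in> borel_measurable (F k)" "integrable Pr (M k)"
      using Fk.real_cond_exp_int(1)[OF X_int] by (auto simp: M_def)
  next
    fix j k assume jk: "j \<le> k \<and> k \<le> n"
    then interpret Fj: finite_measure_subalgebra Pr "F j"
      using fms by simp
    \<comment> \<open>Tower property: \<open>M\<close> is a martingale closed by
      \<open>?S n - \<alpha> n\<close>.\<close>
    have "AE \<omega> in Pr. real_cond_exp Pr (F j) (M k) \<omega> = M j \<omega>"
      unfolding M_def using jk sub sub_mono X_int
      by (intro Fj.real_cond_exp_nested_subalg) auto
    then show "AE \<omega> in Pr. real_cond_exp Pr (F j) (M k) \<omega> \<le> M j \<omega>"
      by eventually_elim simp
  qed
  moreover have "CVaR Pr lam (\<lambda>\<omega>. max (?S k \<omega> - M k \<omega>) 0) \<le> ereal (\<alpha> k)" if k: "k \<in> {1..n}" for k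
  proof (rule CVaR_le_const)
    interpret Fk: finite_measure_subalgebra Pr "F k"
      using fms k by simp
    have Y: "integrable Pr (\<lambda>\<omega>. ?S k \<omega> - \<alpha> k)" "(\<lambda>\<omega>. ?S k \<omega> - \<alpha> k) \<in> borel_measurable (F k)"
      using S_int S_meas k by auto
    \<comment> \<open>Monotonicity is used only between times \<open>k\<close> and \<open>n\<close>.
      Conditioning on \<open>F k\<close> then leaves the left side unchanged, as it is
      \<open>F k\<close>-measurable, and turns the right side into \<open>M k\<close>.\<close>
    have "AE \<omega> in Pr. ?S k \<omega> - \<alpha> k \<le> ?S n \<omega> - \<alpha> n"
      using assms(10) by eventually_elim (use k n in \<open>auto dest!: mono_onD[of _ _ k n]\<close>)
    then have "AE \<omega> in Pr. real_cond_exp Pr (F k) (\<lambda>\<omega>. ?S k \<omega> - \<alpha> k) \<omega> \<le> M k \<omega>"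
      unfolding M_def using X_int Y(1) by (intro Fk.real_cond_exp_mono)
    \<comment> \<open>Rearranging gives \<open>?S k - M k \<le> \<alpha> k\<close>; since
      \<open>\<alpha> k \<ge> 0\<close>, the bound survives taking the positive part.\<close>
    then show "AE \<omega> in Pr. max (?S k \<omega> - M k \<omega>) 0 \<le> \<alpha> k"
      using Fk.real_cond_exp_F_meas[OF Y] by eventually_elim (use assms(9)[OF k] in auto)
  qed (use assms(9)[OF k] in simp)
  ultimately have "M \<in> M_CVaR Pr n F lam ?S \<alpha>"
    by (simp add: M_CVaR_def)
  \<comment> \<open>Triviality of \<open>F 0\<close> makes the initial value the plain expectation
    of the terminal one, so \<open>M\<close> attains the lower bound.\<close>
  moreover have "AE \<omega> in Pr. M 0 \<omega> = ?v"
    using real_cond_exp_trivial_algebra[OF sub[of 0] assms(4) X_int] S_int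
    by (simp add: M_def prob_space)
  ultimately show ?thesis
    unfolding V0_CVaR_def
    by (intro antisym Inf_lower Inf_greatest) (auto intro: lower)
qed

end
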